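(* Let $\alpha,\beta,\gamma$ be distinct stack variables, let $U := \mu\gamma.\,\mathsf{car}(\alpha)\star\alpha$ and let $W[\cdot]$ be the context $$W[\cdot] := \mu\alpha.\,\mathsf{car}(\alpha)\star\big((\mu\beta.\,\mathsf{car}(\alpha)\star U::[\cdot]::\alpha)::U::\alpha\big).$$ Then for all terms $M,N$ of the stack calculus we have $W[M]\simeq W[N]$.
   Context: The stack calculus. Fix a countably infinite set of stack variables $\alpha,\beta,\gamma,\ldots$. Expressions are generated by: stacks $\pi ::= \mathsf{nil}\mid\alpha\mid\mathsf{cdr}(\pi)\mid M::\pi$; terms $M ::= \mathsf{car}(\pi)\mid \mu\alpha.P$; processes $P ::= M\star\pi$. The operator $::$ associates to the right and binds more tightly than $\star$ (so $M\star N::\pi$ means $M\star(N::\pi)$). $\mu\alpha$ binds $\alpha$; $E\{\pi/\alpha\}$ denotes capture-avoiding substitution of the stack $\pi$ for the free occurrences of $\alpha$ in $E$. Reduction rules: $(\mu\alpha.P)\star\pi\to P\{\pi/\alpha\}$, $\mathsf{car}(M::\pi)\to M$, $\mathsf{cdr}(M::\pi)\to\pi$; $\to_s$ is their contextual closure, $\twoheadrightarrow_s$ its reflexive-transitive closure and $=_s$ its equivalence closure. Write $\mathsf{cdr}^n(\pi)$ for $n$-fold application of $\mathsf{cdr}$ and $\mathsf{car}_n(\pi):=\mathsf{car}(\mathsf{cdr}^n(\pi))$. Every expression has a unique normal form with respect to the $\mathsf{car}$ and $\mathsf{cdr}$ rules alone, its canonical form. Outer reduction (deterministic, no contextual closure):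 $M\to_o \mu\alpha.P\{\pi/\beta\}$ if $\mu\alpha.(\mu\beta.P)\star\pi$ is the canonical form of $M$. A term is an outer normal form (onf) if it is not $\to_o$-reducible; such terms are exactly those of shape $\mu\alpha.H\star N_1::\cdots::N_m::\tau$ with $H$ either $\mathsf{car}_n(\beta)$ (the onf is proper) or $\mathsf{car}_n(\mathsf{nil})$ (improper), and $\tau$ either $\mathsf{cdr}^k(\gamma)$ or $\mathsf{cdr}^k(\mathsf{nil})$. A term has a proper onf if it $\to_o$-reduces in finitely many steps to a proper onf. Head contexts are generated by $C[\cdot]::=[\cdot]\mid \mu\alpha.C[\cdot]\star\pi$ (filling the hole may capture variables). Two terms are operationally equivalent, $M\simeq N$, if for every head context $C[\cdot]$, $C[M]$ has a proper onf iff $C[N]$ has a proper onf. *)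

theory Defs
  imports Main
begin

text \<open>
  Expressions are represented by de Bruijn terms in which the free indices serve as the names of
  the stack variables.  As every de Bruijn term then denotes exactly one alpha-equivalence class of
  named expressions, no well-formedness predicate is needed.  The named binder is \<open>mu\<close> below.
\<close>

datatype stack =
    SNil
  | SVar nat
  | Cdr stack
  | SCons trm stack (infixr "##" 65)
and trm =
    Car stack
  | Mu proc
and proc =
    Star trm stack (infix "\<star>" 60)

primrec ren_s :: "(nat \<Rightarrow> nat) \<Rightarrow> stack \<Rightarrow> stack"
  and ren_t :: "(nat \<Rightarrow> nat) \<Rightarrow> trm \<Rightarrow> trm"
  and ren_p :: "(nat \<Rightarrow> nat) \<Rightarrow> proc \<Rightarrow> proc"
where
  "ren_s r SNil = SNil"
| "ren_s r (SVar x) = SVar (r x)"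
| "ren_s r (Cdr s) = Cdr (ren_s r s)"
| "ren_s r (M ## s) = ren_t r M ## ren_s r s"
| "ren_t r (Car s) = Car (ren_s r s)"
| "ren_t r (Mu P) = Mu (ren_p (case_nat 0 (\<lambda>i. Suc (r i))) P)"
| "ren_p r (M \<star> s) = ren_t r M \<star> ren_s r s"

text \<open>Simultaneous capture-avoiding substitution.\<close>

primrec sub_s :: "(nat \<Rightarrow> stack) \<Rightarrow> stack \<Rightarrow> stack"
  and sub_t :: "(nat \<Rightarrow> stack) \<Rightarrow> trm \<Rightarrow> trm"
  and sub_p :: "(nat \<Rightarrow> stack) \<Rightarrow> proc \<Rightarrow> proc"
where
  "sub_s f SNil = SNil"
| "sub_s f (SVar x) = f x"
| "sub_s f (Cdr s) = Cdr (sub_s f s)"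
| "sub_s f (M ## s) = sub_t f M ## sub_s f s"
| "sub_t f (Car s) = Car (sub_s f s)"
| "sub_t f (Mu P) = Mu (sub_p (case_nat (SVar 0) (\<lambda>i. ren_s Suc (f i))) P)"
| "sub_p f (M \<star> s) = sub_t f M \<star> sub_s f s"

text \<open>
  \<open>mu a P\<close> is the named abstraction: it binds the free occurrences of the variable \<open>a\<close> in \<open>P\<close>.
\<close>

definition mu :: "nat \<Rightarrow> proc \<Rightarrow> trm" where
  "mu a P = Mu (ren_p (\<lambda>i. if i = a then 0 else Suc i) P)"

definition inst :: "proc \<Rightarrow> stack \<Rightarrow> proc" where
  "inst P s = sub_p (case_nat s SVar) P"

text \<open>
  The following lemmas relate the de Bruijn operations to the named ones: contracting
  \<open>mu b P\<close> against \<open>s\<close> substitutes \<open>s\<close> for \<open>b\<close>, the name of a bound variable is irrelevant, and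
  every \<open>Mu\<close>-term is a named abstraction.
\<close>

lemma sub_ren:
  "sub_s f (ren_s r s) = sub_s (\<lambda>i. f (r i)) s"
  "sub_t f (ren_t r M) = sub_t (\<lambda>i. f (r i)) M"
  "sub_p f (ren_p r P) = sub_p (\<lambda>i. f (r i)) P"
proof (induction s and M and P arbitrary: f r and f r and f r)
  case (Mu P)
  have "(\<lambda>i. case_nat (SVar 0) (\<lambda>i. ren_s Suc (f i)) (case_nat 0 (\<lambda>i. Suc (r i)) i))
      = case_nat (SVar 0) (\<lambda>i. ren_s Suc (f (r i)))"
    by (auto split: nat.split)
  then show ?case by (simp add: Mu)
qed auto

primrec fv_s :: "stack \<Rightarrow> nat set" and fv_t :: "trm \<Rightarrow> nat set" and fv_p :: "proc \<Rightarrow> nat set"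
where
  "fv_s SNil = {}"
| "fv_s (SVar x) = {x}"
| "fv_s (Cdr s) = fv_s s"
| "fv_s (M ## s) = fv_t M \<union> fv_s s"
| "fv_t (Car s) = fv_s s"
| "fv_t (Mu P) = Suc -` fv_p P"
| "fv_p (M \<star> s) = fv_t M \<union> fv_s s"

lemma finite_fv: "finite (fv_s s)" "finite (fv_t M)" "finite (fv_p P)"
  by (induction s and M and P) (auto intro: finite_vimageI)

lemma ren_cong:
  "\<forall>i\<in>fv_s s. q i = r i \<Longrightarrow> ren_s q s = ren_s r s"
  "\<forall>i\<in>fv_t M. q i = r i \<Longrightarrow> ren_t q M = ren_t r M"
  "\<forall>i\<in>fv_p P. q i = r i \<Longrightarrow> ren_p q P = ren_p r P"
proof (induction s and M and P arbitrary: q r and q r and q r)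
  case (SCons M s)
  show ?case
    using SCons.IH(1)[of q r] SCons.IH(2)[of q r] SCons.prems by simp
next
  case (Car s)
  show ?case
    using Car.IH[of q r] Car.prems by simp
next
  case (Cdr s)
  show ?case
    using Cdr.IH[of q r] Cdr.prems by simp
next
  case (Star M s)
  show ?case
    using Star.IH(1)[of q r] Star.IH(2)[of q r] Star.prems by simp
next
  case (Mu P)
  have "\<forall>i\<in>fv_p P. case_nat 0 (\<lambda>i. Suc (q i)) i = case_nat 0 (\<lambda>i. Suc (r i)) i"
    using Mu.prems by (auto split: nat.split)
  from Mu.IH[OF this] show ?case by simp
qed simp_all

lemma ren_ren:
  "ren_s q (ren_s r s) = ren_s (\<lambda>i. q (r i)) s"
  "ren_t q (ren_t r M) = ren_t (\<lambda>i. q (r i)) M"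
  "ren_p q (ren_p r P) = ren_p (\<lambda>i. q (r i)) P"
proof (induction s and M and P arbitrary: q r and q r and q r)
  case (Mu P)
  have "(\<lambda>i. case_nat 0 (\<lambda>i. Suc (q i)) (case_nat 0 (\<lambda>i. Suc (r i)) i))
      = case_nat 0 (\<lambda>i. Suc (q (r i)))"
    by (auto split: nat.split)
  then show ?case by (simp add: Mu)
qed auto

lemma ren_ident:
  "ren_s (\<lambda>i. i) s = s" "ren_t (\<lambda>i. i) M = M" "ren_p (\<lambda>i. i) P = P"
proof (induction s and M and P)
  case (Mu P)
  have "case_nat 0 Suc = (\<lambda>i. i)"
    by (auto split: nat.split)
  then show ?case by (simp add: Mu)
qed auto

lemma sub_SVar:
  "sub_s (\<lambda>i. SVar (r i)) s = ren_s r s"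
  "sub_t (\<lambda>i. SVar (r i)) M = ren_t r M"
  "sub_p (\<lambda>i. SVar (r i)) P = ren_p r P"
proof (induction s and M and P arbitrary: r and r and r)
  case (Mu P)
  have "case_nat (SVar 0) (\<lambda>i. SVar (Suc (r i))) = (\<lambda>i. SVar (case_nat 0 (\<lambda>i. Suc (r i)) i))"
    by (auto split: nat.split)
  then show ?case by (simp add: Mu)
qed auto

lemma mu_beta:
  obtains P' where "mu b P = Mu P'" "\<And>s. inst P' s = sub_p (SVar(b := s)) P"
proof
  fix s
  have "(\<lambda>i. case_nat s SVar (if i = b then 0 else Suc i)) = SVar(b := s)"
    by (auto split: nat.split)
  then show "inst (ren_p (\<lambda>i. if i = b then 0 else Suc i) P) s = sub_p (SVar(b := s)) P"
    by (simp add: inst_def sub_ren)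
qed (simp add: mu_def)

lemma mu_alpha:
  assumes "c \<notin> fv_p P"
  shows "mu c (sub_p (SVar(a := SVar c)) P) = mu a P"
proof -
  have *: "SVar(a := SVar c) = (\<lambda>i. SVar (if i = a then c else i))"
    by auto
  show ?thesis
    unfolding mu_def * sub_SVar ren_ren
    by (rule arg_cong[where f = Mu], rule ren_cong) (use assms in auto)
qed

lemma Mu_eq_mu: "\<exists>a Q. Mu P = mu a Q"
proof -
  obtain a where a: "a \<notin> Suc -` fv_p P"
    using ex_new_if_finite[OF infinite_UNIV_nat finite_vimageI[OF finite_fv(3) inj_Suc]] by blast
  have "ren_p (\<lambda>i. if case_nat a (\<lambda>i. i) i = a then 0 else Suc (case_nat a (\<lambda>i. i) i)) P
      = ren_p (\<lambda>i. i) P"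
    by (rule ren_cong) (use a in \<open>auto split: nat.split\<close>)
  then have "Mu P = mu a (ren_p (case_nat a (\<lambda>i. i)) P)"
    by (simp add: mu_def ren_ren ren_ident)
  then show ?thesis by blast
qed

text \<open>The contextual closure of the \<open>car\<close> and \<open>cdr\<close> rules (without the \<open>\<mu>\<close> rule).\<close>

inductive cc_s :: "stack \<Rightarrow> stack \<Rightarrow> bool"
  and cc_t :: "trm \<Rightarrow> trm \<Rightarrow> bool"
  and cc_p :: "proc \<Rightarrow> proc \<Rightarrow> bool"
where
  cdr: "cc_s (Cdr (M ## s)) s"
| car: "cc_t (Car (M ## s)) M"
| in_Cdr: "cc_s s s' \<Longrightarrow> cc_s (Cdr s) (Cdr s')"
| in_SCons_l: "cc_t M M' \<Longrightarrow> cc_s (M ## s) (M' ## s)"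
| in_SCons_r: "cc_s s s' \<Longrightarrow> cc_s (M ## s) (M ## s')"
| in_Car: "cc_s s s' \<Longrightarrow> cc_t (Car s) (Car s')"
| in_Mu: "cc_p P P' \<Longrightarrow> cc_t (Mu P) (Mu P')"
| in_Star_l: "cc_t M M' \<Longrightarrow> cc_p (M \<star> s) (M' \<star> s)"
| in_Star_r: "cc_s s s' \<Longrightarrow> cc_p (M \<star> s) (M \<star> s')"

definition canonical_form :: "trm \<Rightarrow> trm \<Rightarrow> bool" where
  "canonical_form M M' \<longleftrightarrow> cc_t\<^sup>*\<^sup>* M M' \<and> (\<nexists>M''. cc_t M' M'')"

inductive outer :: "trm \<Rightarrow> trm \<Rightarrow> bool" where
  "canonical_form M (Mu (Mu P \<star> s)) \<Longrightarrow> outer M (Mu (inst P s))"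

lemma ren_sub:
  "ren_s q (sub_s f s) = sub_s (\<lambda>i. ren_s q (f i)) s"
  "ren_t q (sub_t f M) = sub_t (\<lambda>i. ren_s q (f i)) M"
  "ren_p q (sub_p f P) = sub_p (\<lambda>i. ren_s q (f i)) P"
proof (induction s and M and P arbitrary: q f and q f and q f)
  case (Mu P)
  have "(\<lambda>i. ren_s (case_nat 0 (\<lambda>i. Suc (q i))) (case_nat (SVar 0) (\<lambda>i. ren_s Suc (f i)) i))
      = case_nat (SVar 0) (\<lambda>i. ren_s Suc (ren_s q (f i)))"
    by (auto simp: ren_ren split: nat.split)
  then show ?case by (simp add: Mu)
qed auto

text \<open>The outer reduction rule in terms of the named binder.\<close>

lemma outer_mu:
  assumes "canonical_form M (mu a (mu b P \<star> s))"
  shows "outer M (mu a (sub_p (SVar(b := s)) P))"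
proof -
  define r where "r = (\<lambda>i. if i = a then 0 else Suc i)"
  define k where "k = (\<lambda>i. if i = b then 0 else Suc i)"
  define P' where "P' = ren_p (case_nat 0 (\<lambda>i. Suc (r i))) (ren_p k P)"
  have "mu a (mu b P \<star> s) = Mu (Mu P' \<star> ren_s r s)"
    by (simp add: mu_def r_def k_def P'_def)
  with assms have "outer M (Mu (inst P' (ren_s r s)))"
    by (simp add: outer.intros)
  moreover have "(\<lambda>i. case_nat (ren_s r s) SVar (case_nat 0 (\<lambda>i. Suc (r i)) (k i)))
      = (\<lambda>i. ren_s r ((SVar(b := s)) i))"
    by (auto simp: k_def split: nat.split)
  then have "inst P' (ren_s r s) = ren_p r (sub_p (SVar(b := s)) P)"
    by (simp add: inst_def sub_ren ren_sub P'_def)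
  ultimately show ?thesis
    by (simp add: mu_def r_def)
qed

definition onf :: "trm \<Rightarrow> bool" where
  "onf M \<longleftrightarrow> (\<nexists>M'. outer M M')"

definition car_n :: "nat \<Rightarrow> stack \<Rightarrow> trm" where
  "car_n n s = Car ((Cdr ^^ n) s)"

text \<open>
  The shape of an outer normal form is read off its canonical form, because outer reducts
  need not be canonical.
\<close>

definition proper_onf :: "trm \<Rightarrow> bool" where
  "proper_onf M \<longleftrightarrow> onf M \<and>
     (\<exists>n b Ns k t. t \<in> insert SNil (range SVar) \<and>
        canonical_form M (Mu (car_n n (SVar b) \<star> foldr SCons Ns ((Cdr ^^ k) t))))"

definition has_proper_onf :: "trm \<Rightarrow> bool" where
  "has_proper_onf M \<longleftrightarrow> (\<exists>M'. outer\<^sup>*\<^sup>* M M' \<and> proper_onf M')"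

datatype head_context = Hole | HMu nat head_context stack

text \<open>The named binder \<open>mu\<close> makes filling capture the free variables of the filled-in term.\<close>

primrec fill :: "head_context \<Rightarrow> trm \<Rightarrow> trm" where
  "fill Hole M = M"
| "fill (HMu a C s) M = mu a (fill C M \<star> s)"

definition op_equiv :: "trm \<Rightarrow> trm \<Rightarrow> bool" (infix "\<simeq>" 50) where
  "M \<simeq> N \<longleftrightarrow> (\<forall>C. has_proper_onf (fill C M) \<longleftrightarrow> has_proper_onf (fill C N))"

definition U :: "nat \<Rightarrow> nat \<Rightarrow> trm" where
  "U \<alpha> \<gamma> = mu \<gamma> (Car (SVar \<alpha>) \<star> SVar \<alpha>)"

definition W :: "nat \<Rightarrow> nat \<Rightarrow> nat \<Rightarrow> trm \<Rightarrow> trm" where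
  "W \<alpha> \<beta> \<gamma> M =
     mu \<alpha> (Car (SVar \<alpha>) \<star>
       mu \<beta> (Car (SVar \<alpha>) \<star> U \<alpha> \<gamma> ## M ## SVar \<alpha>) ## U \<alpha> \<gamma> ## SVar \<alpha>)"

end

theory Submission
  imports Defs
begin

text \<open>
  In a head context, \<open>W M\<close> ends up applied to a stack \<open>s\<close> that does not mention \<open>M\<close>, and becomes
  \<open>Car s \<star> V ## U ## s\<close>, where \<open>V\<close>, the abstraction over \<open>\<beta>\<close>, and \<open>U\<close> both discard
  their argument stack.  Until \<open>V\<close> or \<open>U\<close> reaches
  the head, they are inert.  If \<open>U\<close> is the first to reach the head, the process becomes
  \<open>Car s \<star> s\<close>, without \<open>M\<close>.  If \<open>V\<close> is, it becomes \<open>Car s \<star> U ## M ## s\<close>, and the run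
  that has just brought the first argument to the head brings \<open>U\<close> there, so that we again end
  up in \<open>Car s \<star> s\<close>.
\<close>

section \<open>Canonical forms\<close>

text \<open>Bottom-up evaluation of the \<open>car\<close> and \<open>cdr\<close> rules. As it is a
  function that is invariant under steps, no separate confluence or termination argument is
  needed.\<close>

primrec nf_s :: "stack \<Rightarrow> stack" and nf_t :: "trm \<Rightarrow> trm" and nf_p :: "proc \<Rightarrow> proc"
where
  "nf_s SNil = SNil"
| "nf_s (SVar x) = SVar x"
| "nf_s (Cdr s) = (case nf_s s of M ## s' \<Rightarrow> s' | s' \<Rightarrow> Cdr s')"
| "nf_s (M ## s) = nf_t M ## nf_s s"
| "nf_t (Car s) = (case nf_s s of M ## s' \<Rightarrow> M | s' \<Rightarrow> Car s')"
| "nf_t (Mu P) = Mu (nf_p P)"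
| "nf_p (M \<star> s) = nf_t M \<star> nf_s s"

lemma nf_cc:
  "cc_s s s' \<Longrightarrow> nf_s s = nf_s s'"
  "cc_t M M' \<Longrightarrow> nf_t M = nf_t M'"
  "cc_p P P' \<Longrightarrow> nf_p P = nf_p P'"
  by (induction rule: cc_s_cc_t_cc_p.inducts) simp_all

lemma nf_cc_rtranclp: "cc_t\<^sup>*\<^sup>* M M' \<Longrightarrow> nf_t M = nf_t M'"
  by (induction rule: rtranclp_induct) (simp_all add: nf_cc)

lemma rtranclp_image:
  assumes "r\<^sup>*\<^sup>* x y" and "\<And>x y. r x y \<Longrightarrow> r' (h x) (h y)"
  shows "r'\<^sup>*\<^sup>* (h x) (h y)"
  using assms(1) by (induction rule: rtranclp_induct) (auto intro: assms(2) rtranclp.rtrancl_into_rtrancl)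

lemma cc_rtranclp_nf:
  "cc_s\<^sup>*\<^sup>* s (nf_s s)"
  "cc_t\<^sup>*\<^sup>* M (nf_t M)"
  "cc_p\<^sup>*\<^sup>* P (nf_p P)"
proof (induction s and M and P)
  case (Cdr s)
  have "cc_s\<^sup>*\<^sup>* (Cdr s) (Cdr (nf_s s))"
    by (rule rtranclp_image[OF Cdr]) (rule in_Cdr)
  then show ?case
    by (auto split: stack.split intro: cc_s_cc_t_cc_p.cdr rtranclp.rtrancl_into_rtrancl)
next
  case (SCons M s)
  have "cc_s\<^sup>*\<^sup>* (M ## s) (nf_t M ## s)"
    by (rule rtranclp_image[OF SCons(1)]) (rule in_SCons_l)
  also have "cc_s\<^sup>*\<^sup>* (nf_t M ## s) (nf_t M ## nf_s s)"
    by (rule rtranclp_image[OF SCons(2)]) (rule in_SCons_r)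
  finally show ?case by simp
next
  case (Car s)
  have "cc_t\<^sup>*\<^sup>* (Car s) (Car (nf_s s))"
    by (rule rtranclp_image[OF Car]) (rule in_Car)
  then show ?case
    by (auto split: stack.split intro: cc_s_cc_t_cc_p.car rtranclp.rtrancl_into_rtrancl)
next
  case (Mu P)
  have "cc_t\<^sup>*\<^sup>* (Mu P) (Mu (nf_p P))"
    by (rule rtranclp_image[OF Mu]) (rule in_Mu)
  then show ?case by simp
next
  case (Star M s)
  have "cc_p\<^sup>*\<^sup>* (M \<star> s) (nf_t M \<star> s)"
    by (rule rtranclp_image[OF Star(1)]) (rule in_Star_l)
  also have "cc_p\<^sup>*\<^sup>* (nf_t M \<star> s) (nf_t M \<star> nf_s s)"
    by (rule rtranclp_image[OF Star(2)]) (rule in_Star_r)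
  finally show ?case by simp
qed simp_all

inductive_cases cc_elims:
  "cc_s SNil s" "cc_s (SVar x) s" "cc_s (Cdr s) s'" "cc_s (M ## s) s'"
  "cc_t (Car s) M" "cc_t (Mu P) M" "cc_p (M \<star> s) P"

lemma nf_normal:
  "\<not> cc_s (nf_s s) s'"
  "\<not> cc_t (nf_t M) M'"
  "\<not> cc_p (nf_p P) P'"
proof (induction s and M and P arbitrary: s' and M' and P')
  case (Cdr s)
  then show ?case
    by (cases "nf_s s") (auto elim: cc_elims dest: in_SCons_r)
next
  case (Car s)
  then show ?case
    by (cases "nf_s s") (auto elim: cc_elims dest: in_SCons_l)
qed (auto elim: cc_elims)

lemma canonical_form_iff: "canonical_form M M' \<longleftrightarrow> nf_t M = M'"
  by (metis canonical_form_def cc_rtranclp_nf(2) converse_rtranclpE nf_cc_rtranclp nf_normal(2))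

text \<open>A \<open>Cdr\<close> either removes the first entry of \<open>Ns\<close> or, if
  \<open>Ns\<close> is empty, is counted in \<open>k\<close>.\<close>

lemma nf_s_shape: "\<exists>Ns k t. t \<in> insert SNil (range SVar) \<and> nf_s s = foldr SCons Ns ((Cdr ^^ k) t)"
proof (induction s rule: stack.induct[where ?P2.0 = "\<lambda>_. True" and ?P3.0 = "\<lambda>_. True"])
  case (Cdr s)
  then obtain Ns k t where *: "t \<in> insert SNil (range SVar)"
      "nf_s s = foldr SCons Ns ((Cdr ^^ k) t)"
    by blast
  show ?case
  proof (cases Ns)
    case Nil
    have "nf_s (Cdr s) = foldr SCons [] ((Cdr ^^ Suc k) t)"
      using * Nil by (cases k) auto
    then show ?thesis using * by blast
  next
    case Cons
    then show ?thesis using * by auto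
  qed
next
  case (SCons M s)
  then obtain Ns k t where *: "t \<in> insert SNil (range SVar)"
      "nf_s s = foldr SCons Ns ((Cdr ^^ k) t)"
    by blast
  then have "nf_s (M ## s) = foldr SCons (nf_t M # Ns) ((Cdr ^^ k) t)"
    by simp
  with * show ?case by blast
next
  case SNil
  have "nf_s SNil = foldr SCons [] ((Cdr ^^ 0) SNil)" by simp
  then show ?case by blast
next
  case (SVar x)
  have "nf_s (SVar x) = foldr SCons [] ((Cdr ^^ 0) (SVar x))" by simp
  then show ?case by blast
qed simp_all

lemma nf_t_shape:
  obtains P where "nf_t M = Mu P"
  | n b where "nf_t M = car_n n (SVar b)"
  | n where "nf_t M = car_n n SNil"
proof (cases "nf_t M")
  case (Car s)
  have normal: "\<not> cc_s s s'" for s'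
    using nf_normal(2)[of M] Car by (auto intro: in_Car)
  then have "nf_s s = s"
    using cc_rtranclp_nf(1)[of s] by (metis converse_rtranclpE)
  then obtain Ns k t where *: "t \<in> insert SNil (range SVar)" "s = foldr SCons Ns ((Cdr ^^ k) t)"
    using nf_s_shape[of s] by auto
  show ?thesis
  proof (cases Ns)
    case Nil
    then show ?thesis using * Car that(2,3) by (auto simp: car_n_def)
  next
    case (Cons N Ns')
    then have "cc_t (nf_t M) N" using * Car by (simp add: cc_s_cc_t_cc_p.car)
    then show ?thesis using nf_normal(2) by blast
  qed
qed (use that in simp)

section \<open>Substitution\<close>

lemma cc_sub:
  "cc_s s s' \<Longrightarrow> cc_s (sub_s f s) (sub_s f s')"
  "cc_t M M' \<Longrightarrow> cc_t (sub_t f M) (sub_t f M')"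
  "cc_p P P' \<Longrightarrow> cc_p (sub_p f P) (sub_p f P')"
  by (induction arbitrary: f and f and f rule: cc_s_cc_t_cc_p.inducts)
    (simp_all add: cc_s_cc_t_cc_p.intros)

lemma nf_sub_cc_rtranclp:
  "cc_s\<^sup>*\<^sup>* s s' \<Longrightarrow> nf_s (sub_s f s') = nf_s (sub_s f s)"
  "cc_t\<^sup>*\<^sup>* M M' \<Longrightarrow> nf_t (sub_t f M') = nf_t (sub_t f M)"
  "cc_p\<^sup>*\<^sup>* P P' \<Longrightarrow> nf_p (sub_p f P') = nf_p (sub_p f P)"
  by (induction rule: rtranclp_induct; metis cc_sub nf_cc)+

text \<open>Substitution preserves \<open>car\<close> and \<open>cdr\<close> steps, so normalising
  beforehand does not change the final canonical form.\<close>

lemma nf_sub_nf: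
  "nf_s (sub_s f (nf_s s)) = nf_s (sub_s f s)"
  "nf_t (sub_t f (nf_t M)) = nf_t (sub_t f M)"
  "nf_p (sub_p f (nf_p P)) = nf_p (sub_p f P)"
  by (rule nf_sub_cc_rtranclp, rule cc_rtranclp_nf)+

lemma nf_sub_eq:
  "nf_s s = nf_s s' \<Longrightarrow> nf_s (sub_s f s) = nf_s (sub_s f s')"
  "nf_t M = nf_t M' \<Longrightarrow> nf_t (sub_t f M) = nf_t (sub_t f M')"
  "nf_p P = nf_p P' \<Longrightarrow> nf_p (sub_p f P) = nf_p (sub_p f P')"
  using nf_sub_nf[of f] by metis+

lemma nf_ren_cong: "nf_s s = nf_s s' \<Longrightarrow> nf_s (ren_s r s) = nf_s (ren_s r s')"
  unfolding sub_SVar(1)[symmetric] by (rule nf_sub_eq(1))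

lemma sub_id: "sub_s SVar s = s" "sub_t SVar M = M" "sub_p SVar P = P"
  using sub_SVar[of "\<lambda>i. i"] by (simp_all add: ren_ident)

lemma nf_nf: "nf_s (nf_s s) = nf_s s" "nf_t (nf_t M) = nf_t M" "nf_p (nf_p P) = nf_p P"
  using nf_sub_nf[of SVar] by (simp_all add: sub_id)

lemma nf_sub_cong:
  "(\<And>i. nf_s (f i) = nf_s (g i)) \<Longrightarrow> nf_s (sub_s f s) = nf_s (sub_s g s)"
  "(\<And>i. nf_s (f i) = nf_s (g i)) \<Longrightarrow> nf_t (sub_t f M) = nf_t (sub_t g M)"
  "(\<And>i. nf_s (f i) = nf_s (g i)) \<Longrightarrow> nf_p (sub_p f P) = nf_p (sub_p g P)"
proof (induction s and M and P arbitrary: f g and f g and f g)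
  case (Mu P)
  have "nf_s (case_nat (SVar 0) (\<lambda>i. ren_s Suc (f i)) i)
      = nf_s (case_nat (SVar 0) (\<lambda>i. ren_s Suc (g i)) i)" for i
    using Mu.prems by (auto split: nat.split intro: nf_ren_cong)
  from Mu.IH[OF this] show ?case by simp
next
  case (SCons M s)
  show ?case using SCons.IH(1)[of f g] SCons.IH(2)[of f g] SCons.prems by simp
next
  case (Star M s)
  show ?case using Star.IH(1)[of f g] Star.IH(2)[of f g] Star.prems by simp
next
  case (Cdr s)
  have "nf_s (sub_s f s) = nf_s (sub_s g s)" by (rule Cdr.IH[OF Cdr.prems])
  then show ?case by simp
next
  case (Car s)
  have "nf_s (sub_s f s) = nf_s (sub_s g s)" by (rule Car.IH[OF Car.prems])
  then show ?case by simp
qed simp_all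

lemma sub_sub:
  "sub_s f (sub_s g s) = sub_s (\<lambda>i. sub_s f (g i)) s"
  "sub_t f (sub_t g M) = sub_t (\<lambda>i. sub_s f (g i)) M"
  "sub_p f (sub_p g P) = sub_p (\<lambda>i. sub_s f (g i)) P"
proof (induction s and M and P arbitrary: f g and f g and f g)
  case (Mu P)
  have "(\<lambda>i. sub_s (case_nat (SVar 0) (\<lambda>i. ren_s Suc (f i)))
        (case_nat (SVar 0) (\<lambda>i. ren_s Suc (g i)) i))
      = case_nat (SVar 0) (\<lambda>i. ren_s Suc (sub_s f (g i)))"
    by (auto simp: sub_ren ren_sub split: nat.split)
  then show ?case by (simp add: Mu)
qed auto

text \<open>The inner substitution is the one that \<open>sub_t f\<close> performs below a
  \<open>Mu\<close>. Together with \<open>sub_inst\<close> this says that substitution commutes with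
  contraction.\<close>

lemma inst_sub: "inst (sub_p (case_nat (SVar 0) (\<lambda>i. ren_s Suc (f i))) P) s = sub_p (case_nat s f) P"
proof -
  have "(\<lambda>i. sub_s (case_nat s SVar) (case_nat (SVar 0) (\<lambda>i. ren_s Suc (f i)) i)) = case_nat s f"
    by (auto simp: sub_ren sub_id split: nat.split)
  then show ?thesis by (simp add: inst_def sub_sub)
qed

lemma sub_inst: "sub_p f (inst P s) = sub_p (case_nat (sub_s f s) f) P"
proof -
  have "(\<lambda>i. sub_s f (case_nat s SVar i)) = case_nat (sub_s f s) f"
    by (auto split: nat.split)
  then show ?thesis by (simp add: inst_def sub_sub)
qed

lemma nf_inst_cong: "nf_p P = nf_p P' \<Longrightarrow> nf_s s = nf_s s' \<Longrightarrow> nf_p (inst P s) = nf_p (inst P' s')"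
proof -
  assume P: "nf_p P = nf_p P'" and s: "nf_s s = nf_s s'"
  have "nf_p (inst P s) = nf_p (inst P' s)"
    using P unfolding inst_def by (rule nf_sub_eq(3))
  also have "\<dots> = nf_p (inst P' s')"
    unfolding inst_def using s by (intro nf_sub_cong(3)) (simp split: nat.split)
  finally show ?thesis .
qed

section \<open>Head runs\<close>

text \<open>Outer reduction to a proper onf with the outermost \<open>Mu\<close> stripped off, so
  that an applied term can be followed directly.\<close>

inductive proper_run :: "proc \<Rightarrow> bool" where
  proper: "nf_p p = car_n n (SVar b) \<star> s \<Longrightarrow> proper_run p"
| step: "nf_p p = Mu P \<star> s \<Longrightarrow> proper_run (inst P s) \<Longrightarrow> proper_run p"

lemma proper_run_cong:
  assumes "nf_p p = nf_p q"
  shows "proper_run p \<longleftrightarrow> proper_run q"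
  using assms by (metis proper_run.simps)

lemma outer_Mu_iff: "outer (Mu p) X \<longleftrightarrow> (\<exists>P s. nf_p p = Mu P \<star> s \<and> X = Mu (inst P s))"
  by (auto simp: outer.simps canonical_form_iff)

lemma proper_onf_Mu_iff: "proper_onf (Mu p) \<longleftrightarrow> (\<exists>n b s. nf_p p = car_n n (SVar b) \<star> s)"
proof
  assume "proper_onf (Mu p)"
  then show "\<exists>n b s. nf_p p = car_n n (SVar b) \<star> s"
    by (auto simp: proper_onf_def canonical_form_iff)
next
  assume "\<exists>n b s. nf_p p = car_n n (SVar b) \<star> s"
  then obtain n b s where *: "nf_p p = car_n n (SVar b) \<star> s" by blast
  obtain T s' where p: "p = T \<star> s'" by (cases p)
  obtain Ns k t where "t \<in> insert SNil (range SVar)" "s = foldr SCons Ns ((Cdr ^^ k) t)"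
    using nf_s_shape[of s'] * p by auto
  then have "nf_t (Mu p) = Mu (car_n n (SVar b) \<star> foldr SCons Ns ((Cdr ^^ k) t))"
      "t \<in> insert SNil (range SVar)"
    using * by simp_all
  moreover have "onf (Mu p)"
    using * by (simp add: onf_def outer_Mu_iff car_n_def)
  ultimately show "proper_onf (Mu p)"
    unfolding proper_onf_def canonical_form_iff by blast
qed

lemma has_proper_onf_Mu_iff: "has_proper_onf (Mu p) \<longleftrightarrow> proper_run p"
proof
  assume "has_proper_onf (Mu p)"
  then obtain X where "outer\<^sup>*\<^sup>* (Mu p) X" "proper_onf X"
    by (auto simp: has_proper_onf_def)
  then show "proper_run p"
  proof (induction "Mu p" arbitrary: p rule: converse_rtranclp_induct)
    case base
    then show ?case by (auto simp: proper_onf_Mu_iff intro: proper)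
  next
    case (step Y)
    then show ?case by (auto simp: outer_Mu_iff intro: proper_run.step)
  qed
next
  assume "proper_run p"
  then show "has_proper_onf (Mu p)"
  proof induction
    case (proper p n b s)
    then have "proper_onf (Mu p)" by (auto simp: proper_onf_Mu_iff)
    then show ?case by (auto simp: has_proper_onf_def)
  next
    case (step p P s)
    then have "outer (Mu p) (Mu (inst P s))" by (auto simp: outer_Mu_iff)
    with step.IH show ?case
      by (meson converse_rtranclp_into_rtranclp has_proper_onf_def)
  qed
qed

text \<open>The rule \<open>step\<close> contracts the canonical parts \<open>nf_p P\<close> and
  \<open>nf_s s\<close>; by \<open>nf_inst_cong\<close> the result agrees with
  \<open>inst P s\<close> up to canonical form.\<close>

lemma proper_run_beta: "proper_run (Mu P \<star> s) \<longleftrightarrow> proper_run (inst P s)"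
proof -
  have "proper_run (Mu P \<star> s) \<longleftrightarrow> proper_run (inst (nf_p P) (nf_s s))"
    by (subst proper_run.simps) (auto simp: car_n_def)
  also have "\<dots> \<longleftrightarrow> proper_run (inst P s)"
    by (intro proper_run_cong nf_inst_cong nf_nf)
  finally show ?thesis .
qed

lemma proper_run_sub_step:
  assumes "nf_p p = Mu P \<star> s"
  shows "proper_run (sub_p f p) \<longleftrightarrow> proper_run (sub_p f (inst P s))"
proof -
  have "proper_run (sub_p f p) \<longleftrightarrow> proper_run (sub_p f (Mu P \<star> s))"
    by (rule proper_run_cong) (metis assms nf_sub_nf(3))
  also have "\<dots> \<longleftrightarrow> proper_run (sub_p f (inst P s))"
    by (simp add: proper_run_beta inst_sub sub_inst)
  finally show ?thesis .
qed

text \<open>The run of an open process up to its first \<open>Car\<close> head, proper or improper.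
  Every substitution instance has to follow it, so it can be computed before the variables are
  filled in.\<close>

inductive head_run :: "proc \<Rightarrow> trm \<Rightarrow> stack \<Rightarrow> bool" where
  stop: "nf_p p = Car t \<star> s \<Longrightarrow> head_run p (Car t) s"
| step: "nf_p p = Mu P \<star> s \<Longrightarrow> head_run (inst P s) H t \<Longrightarrow> head_run p H t"

lemma head_run_shape:
  assumes "head_run p H s"
  obtains n b where "H = car_n n (SVar b)" | n where "H = car_n n SNil"
  using assms
proof (induction arbitrary: thesis)
  case (stop p t s)
  obtain T s' where p: "p = T \<star> s'" by (cases p)
  show ?case using nf_t_shape[of T] stop p
    by (metis nf_p.simps proc.inject trm.distinct(1))
qed blast

lemma head_run_proper_run: "head_run p H s \<Longrightarrow> proper_run (sub_p f p) \<longleftrightarrow> proper_run (sub_t f H \<star> sub_s f s)"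
proof (induction rule: head_run.induct)
  case (stop p t s)
  then show ?case by (intro proper_run_cong) (metis nf_sub_nf(3) sub_p.simps)
next
  case (step p P s H t)
  then show ?case using proper_run_sub_step by blast
qed

text \<open>Each contraction of \<open>p\<close> is matched by one of its instance, so a finite run
  of the instance bounds the run of \<open>p\<close>.\<close>

lemma head_run_if_proper_run_sub:
  assumes "proper_run (sub_p f p)"
  shows "\<exists>H s. head_run p H s"
proof -
  \<comment> \<open>The induction runs over a separate \<open>q\<close> because contracting
    canonical parts yields an instance of the next process only up to canonical form.\<close>
  have "\<exists>H s. head_run p H s" if "proper_run q" "nf_p q = nf_p (sub_p f p)" for q
    using that
  proof (induction arbitrary: p)
    case (proper q n b s)
    obtain T t where T: "nf_p p = T \<star> t" by (cases "nf_p p")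
    have "nf_p (sub_p f (T \<star> t)) = car_n n (SVar b) \<star> s"
      by (metis T nf_sub_nf(3) proper)
    \<comment> \<open>A \<open>Mu\<close> at the head would survive both substitution and
      normalisation.\<close>
    then obtain u where "T = Car u" by (cases T) (auto simp: car_n_def)
    then show ?case using T stop by blast
  next
    case (step q P s)
    obtain T t where T: "nf_p p = T \<star> t" by (cases "nf_p p")
    show ?case
    proof (cases T)
      case (Car u)
      then show ?thesis using T stop by blast
    next
      case (Mu Q)
      let ?Q = "sub_p (case_nat (SVar 0) (\<lambda>i. ren_s Suc (f i))) Q"
      have "nf_p (sub_p f (Mu Q \<star> t)) = Mu P \<star> s"
        by (metis T Mu nf_sub_nf(3) step.hyps(1) step.prems)
      then have "P = nf_p ?Q" "s = nf_s (sub_s f t)" by simp_all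
      then have "nf_p (inst P s) = nf_p (inst ?Q (sub_s f t))"
        by (intro nf_inst_cong) (simp_all add: nf_nf)
      also have "\<dots> = nf_p (sub_p f (inst Q t))"
        by (simp add: inst_sub sub_inst)
      finally obtain H u where "head_run (inst Q t) H u" using step.IH by blast
      then show ?thesis using T Mu head_run.step by blast
    qed
  qed
  then show ?thesis using assms by blast
qed

lemma nf_car_n: "t \<in> insert SNil (range SVar) \<Longrightarrow> nf_t (car_n n t) = car_n n t"
proof -
  assume t: "t \<in> insert SNil (range SVar)"
  have "nf_s ((Cdr ^^ n) t) = (Cdr ^^ n) t \<and> (\<forall>M s. (Cdr ^^ n) t \<noteq> M ## s)"
    using t by (induction n) (auto split: stack.split)
  then show ?thesis by (auto simp: car_n_def split: stack.split)
qed

lemma proper_run_car_n_SVar: "proper_run (car_n n (SVar b) \<star> s)"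
  by (rule proper) (simp add: nf_car_n)

text \<open>Free variables tell \<open>car_n n SNil\<close> apart from every
  \<open>car_n m (SVar b)\<close>.\<close>

lemma fv_car_n: "fv_t (car_n n t) = fv_s t"
proof -
  have "fv_s ((Cdr ^^ n) t) = fv_s t" by (induction n) simp_all
  then show ?thesis by (simp add: car_n_def)
qed

lemma not_proper_run_car_n_SNil: "\<not> proper_run (car_n n SNil \<star> s)"
proof
  assume "proper_run (car_n n SNil \<star> s)"
  then show False
  proof cases
    case (proper m b s)
    then have "fv_t (car_n n SNil) = fv_t (car_n m (SVar b))" by (simp add: nf_car_n)
    then show False by (simp add: fv_car_n)
  next
    case (step P s)
    then show False using nf_car_n[of SNil n] by (simp add: car_n_def)
  qed
qed

text \<open>
  The variable \<open>0\<close> of \<open>p\<close> stands for a pair of inert terms.  A run of \<open>p\<close> stops with an entry of that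
  pair at the head, or without using the pair; entries after the second are \<open>car_n n SNil\<close>,
  hence improper.
\<close>

lemma proper_run_inst_cases:
  obtains (const) v where "\<And>A B. proper_run (inst p (A ## B ## SNil)) \<longleftrightarrow> v"
  | (fst) "\<And>A B. \<exists>t. proper_run (inst p (A ## B ## SNil)) \<longleftrightarrow> proper_run (A \<star> t)"
  | (snd) "\<And>A B. \<exists>t. proper_run (inst p (A ## B ## SNil)) \<longleftrightarrow> proper_run (B \<star> t)"
proof (cases "\<exists>H s. head_run p H s")
  case False
  then show ?thesis
    using const[of False] head_run_if_proper_run_sub by (metis inst_def)
next
  case True
  then obtain H s where run: "head_run p H s" by blast
  \<comment> \<open>\<open>H\<close> and \<open>s\<close> are fixed before \<open>A\<close> and
    \<open>B\<close> are chosen, so one alternative serves all pairs.\<close>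
  define f where "f A B = case_nat (A ## B ## SNil) SVar" for A B
  have eq: "proper_run (inst p (A ## B ## SNil)) \<longleftrightarrow> proper_run (sub_t (f A B) H \<star> sub_s (f A B) s)" for A B
    using head_run_proper_run[OF run] by (simp add: inst_def f_def)
  have sub_car_n: "sub_t g (car_n n t) = car_n n (sub_s g t)" for g n t
  proof -
    have "sub_s g ((Cdr ^^ n) t) = (Cdr ^^ n) (sub_s g t)" by (induction n) simp_all
    then show ?thesis by (simp add: car_n_def)
  qed
  from run show ?thesis
  proof (cases rule: head_run_shape)
    case (1 n b)
    show ?thesis
    proof (cases b)
      case (Suc c)
      then have "proper_run (inst p (A ## B ## SNil))" for A B
        by (simp add: eq 1 sub_car_n f_def proper_run_car_n_SVar)
      then show ?thesis using const[of True] by blast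
    next
      case 0
      then have eq': "proper_run (inst p (A ## B ## SNil))
          \<longleftrightarrow> proper_run (car_n n (A ## B ## SNil) \<star> sub_s (f A B) s)" for A B
        by (simp add: eq 1 sub_car_n f_def)
      \<comment> \<open>\<open>n\<close> counts the entries skipped: none selects \<open>A\<close>,
        one selects \<open>B\<close>, and more lead into \<open>SNil\<close>.\<close>
      consider "n = 0" | "n = Suc 0" | m where "n = Suc (Suc m)"
        by (metis nat.exhaust)
      then show ?thesis
      proof cases
        case 1
        have "proper_run (car_n n (A ## B ## SNil) \<star> t) \<longleftrightarrow> proper_run (A \<star> t)" for A B t
          by (rule proper_run_cong) (simp add: 1 car_n_def)
        then show ?thesis using fst eq' by blast
      next
        case 2
        have "proper_run (car_n n (A ## B ## SNil) \<star> t) \<longleftrightarrow> proper_run (B \<star> t)" for A B t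
          by (rule proper_run_cong) (simp add: 2 car_n_def)
        then show ?thesis using snd eq' by blast
      next
        case 3
        have *: "nf_s ((Cdr ^^ Suc (Suc m)) (A ## B ## SNil)) = nf_s ((Cdr ^^ m) SNil)" for A B
          by (induction m) simp_all
        have "proper_run (car_n n (A ## B ## SNil) \<star> t) \<longleftrightarrow> proper_run (car_n m SNil \<star> t)" for A B t
          by (rule proper_run_cong) (simp only: 3 car_n_def nf_p.simps nf_t.simps *)
        then show ?thesis using const[of False] eq' not_proper_run_car_n_SNil by blast
      qed
    qed
  next
    case (2 n)
    then have "\<not> proper_run (inst p (A ## B ## SNil))" for A B
      by (simp add: eq sub_car_n not_proper_run_car_n_SNil)
    then show ?thesis using const[of False] by blast
  qed
qed

section \<open>Independence of the hole\<close>

text \<open>The instances at \<open>s\<close> of \<open>U\<close> and of the first argument in \<open>W M\<close>, with \<open>X\<close> for \<open>M\<close>.\<close>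

definition U_at :: "stack \<Rightarrow> trm" where
  "U_at s = Mu (ren_p Suc (Car s \<star> s))"

definition V_at :: "stack \<Rightarrow> trm \<Rightarrow> trm" where
  "V_at s X = Mu (ren_t Suc (Car s) \<star> ren_t Suc (U_at s) ## X ## ren_s Suc s)"

lemma proper_run_U_at: "proper_run (U_at s \<star> t) \<longleftrightarrow> proper_run (Car s \<star> s)"
  by (simp add: U_at_def proper_run_beta inst_def sub_ren sub_id)

text \<open>\<open>X\<close> lies below the binder, so contraction may insert \<open>t\<close> into
  it; hence only some \<open>X'\<close> is claimed.\<close>

lemma proper_run_V_at:
  "\<exists>X'. proper_run (V_at s X \<star> t) \<longleftrightarrow> proper_run (Car s \<star> U_at s ## X' ## s)"
  by (auto simp: V_at_def proper_run_beta inst_def sub_ren sub_id)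

lemma proper_run_V_at_indep:
  "proper_run (Car s \<star> V_at s X ## U_at s ## s) \<longleftrightarrow> proper_run (Car s \<star> V_at s Y ## U_at s ## s)"
proof -
  \<comment> \<open>A single variable holds both arguments, read off by projections, since
    \<open>inst\<close> replaces only the variable \<open>0\<close>.\<close>
  define K where "K = ren_t Suc (Car s) \<star> Car (SVar 0) ## Car (Cdr (SVar 0)) ## ren_s Suc s"
  have K: "proper_run (inst K (A ## B ## SNil)) \<longleftrightarrow> proper_run (Car s \<star> A ## B ## s)" for A B
    by (rule proper_run_cong) (simp add: K_def inst_def sub_ren sub_id)
  show ?thesis
    \<comment> \<open>The alternative \<open>fst\<close> is used twice, for the pair of
      \<open>V_at\<close> and \<open>U_at\<close> and then for the pair of \<open>U_at\<close> and
      \<open>X'\<close>.\<close>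
    by (cases K rule: proper_run_inst_cases) (metis K proper_run_U_at proper_run_V_at)+
qed

lemma proper_run_sub_mu: "proper_run (sub_t f (mu a P) \<star> s) \<longleftrightarrow> proper_run (sub_p (f(a := s)) P)"
proof -
  have "(\<lambda>i. case_nat s f (if i = a then 0 else Suc i)) = f(a := s)"
    by (auto split: nat.split)
  then show ?thesis
    \<comment> \<open>\<open>sub_ren\<close> comes last: fusing the renaming earlier would hide the
      pattern of \<open>inst_sub\<close>.\<close>
    by (simp only: mu_def sub_t.simps proper_run_beta inst_sub) (simp only: sub_ren)
qed

lemma sub_mu: "sub_t f (mu a P) = Mu (sub_p ((\<lambda>i. ren_s Suc (f i))(a := SVar 0)) P)"
proof -
  have "(\<lambda>i. case_nat (SVar 0) (\<lambda>i. ren_s Suc (f i)) (if i = a then 0 else Suc i))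
      = (\<lambda>i. ren_s Suc (f i))(a := SVar 0)"
    by (auto split: nat.split)
  then show ?thesis by (simp add: mu_def sub_ren)
qed

text \<open>\<open>f\<close> is an environment: each layer of the head context adds its binding to
  \<open>f\<close>, which accounts for capture, and supplies the next stack.\<close>

lemma proper_run_fill_W:
  assumes "distinct [\<alpha>, \<beta>, \<gamma>]"
  shows "proper_run (sub_t f (fill C (W \<alpha> \<beta> \<gamma> M)) \<star> s) \<longleftrightarrow> proper_run (sub_t f (fill C (W \<alpha> \<beta> \<gamma> N)) \<star> s)"
proof (induction C arbitrary: f s)
  case Hole
  \<comment> \<open>The hole survives only inside \<open>X\<close>. As \<beta> and \<gamma> differ
    from \<alpha>, their binders leave the binding of \<alpha> to \<open>s\<close> intact, up to a
    shift.\<close>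
  have "\<exists>X. proper_run (sub_t f (W \<alpha> \<beta> \<gamma> M) \<star> s) \<longleftrightarrow>
      proper_run (Car s \<star> V_at s X ## U_at s ## s)" for M
    unfolding W_def U_def proper_run_sub_mu U_at_def V_at_def
    using assms by (auto simp: sub_mu ren_ren)
  then show ?case using proper_run_V_at_indep by (metis fill.simps(1))
next
  case (HMu a C t)
  then show ?case by (simp only: fill.simps proper_run_sub_mu sub_p.simps)
qed

theorem theorem2:
  fixes \<alpha> \<beta> \<gamma> :: nat and M N :: trm
  assumes "distinct [\<alpha>, \<beta>, \<gamma>]"
  shows "W \<alpha> \<beta> \<gamma> M \<simeq> W \<alpha> \<beta> \<gamma> N"
  unfolding op_equiv_def
proof
  fix C
  show "has_proper_onf (fill C (W \<alpha> \<beta> \<gamma> M)) \<longleftrightarrow> has_proper_onf (fill C (W \<alpha> \<beta> \<gamma> N))"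
  proof (cases C)
    case Hole
    \<comment> \<open>Unapplied, the term is already a proper onf: its head is \<open>Car\<close> of
      the bound \<alpha>, which has index \<open>0\<close>.\<close>
    have "has_proper_onf (W \<alpha> \<beta> \<gamma> M)" for M
      unfolding W_def mu_def has_proper_onf_Mu_iff
      by (rule proper[where n = 0 and b = 0]) (simp add: car_n_def)
    then show ?thesis using Hole by simp
  next
    case (HMu a D s)
    show ?thesis
      unfolding HMu fill.simps mu_def has_proper_onf_Mu_iff
      \<comment> \<open>The initial environment is the renaming performed by \<open>mu a\<close>,
        written as a substitution.\<close>
      using proper_run_fill_W[OF assms, of "\<lambda>i. SVar (if i = a then 0 else Suc i)" D]
      by (simp add: sub_SVar)
  qed
qed

end
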